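(* Let $\epsilon\in\left(0,\frac12\right)$ and let $n\ge 1/\epsilon$ be an integer. Let $f_n(\epsilon)$ be the maximum value such that every even-sized family $\mathcal A\subseteq 2^{[n]}$ with $|\mathcal A|\ge 2^{(1-\epsilon)n}$ satisfies $op(\mathcal A)\ge f_n(\epsilon)\binom{|\mathcal A|}{2}$. Then $$\frac12\left(1-2^{\left(\epsilon-\frac12\right)n}\right)\le f_n(\epsilon)\le \begin{cases}\frac12, & n\text{ odd;}\\ \frac12\left(1-\frac{1}{2^{n-1}-1}\right), & n\text{ even.}\end{cases}$$ Hence for fixed $\epsilon\in\left(0,\frac12\right)$, $\lim_{n\to\infty}f_n(\epsilon)=\frac12$.
   Context: $[n]=\{1,2,\ldots,n\}$ and $2^{[n]}$ is the collection of all subsets of $[n]$. A family $\mathcal A\subseteq 2^{[n]}$ is a set of (distinct) subsets of $[n]$; it is even-sized if every member has even cardinality. The odd pair number $op(\mathcal A)$ is the number of (unordered) pairs of distinct members $A,B\in\mathcal A$ such that $|A\cap B|$ is odd. *)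

theory Defs
  imports Complex_Main
begin

definition even_sized :: "nat set set \<Rightarrow> bool" where
  "even_sized \<A> \<longleftrightarrow> (\<forall>A\<in>\<A>. even (card A))"

definition odd_pair_number :: "nat set set \<Rightarrow> nat" where
  "odd_pair_number \<A> = card {{A, B} | A B. A \<in> \<A> \<and> B \<in> \<A> \<and> A \<noteq> B \<and> odd (card (A \<inter> B))}"

definition large_even_families :: "nat \<Rightarrow> real \<Rightarrow> nat set set set" where
  "large_even_families n \<epsilon> =
     {\<A>. \<A> \<subseteq> Pow {1..n} \<and> even_sized \<A> \<and> real (card \<A>) \<ge> 2 powr ((1 - \<epsilon>) * real n)}"

definition op_density_bound :: "nat \<Rightarrow> real \<Rightarrow> real \<Rightarrow> bool" where
  "op_density_bound n \<epsilon> c \<longleftrightarrow>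
     (\<forall>\<A>\<in>large_even_families n \<epsilon>. real (odd_pair_number \<A>) \<ge> c * real (card \<A> choose 2))"

text \<open>\<^const>\<open>Greatest\<close> is unspecified when no maximum exists; the lemma
  \<open>max_op_density_is_maximum\<close> below shows that this does not happen for \<open>0 < \<epsilon> < 1/2\<close> and \<open>n \<ge> 1/\<epsilon>\<close>.\<close>

definition max_op_density :: "nat \<Rightarrow> real \<Rightarrow> real" where
  "max_op_density n \<epsilon> = (GREATEST c. op_density_bound n \<epsilon> c)"

lemma card_even_subsets:
  assumes "n \<ge> 1"
  shows "card {A. A \<subseteq> {1..n} \<and> even (card A)} = 2 ^ (n - 1)"
proof -
  let ?E = "{A. A \<subseteq> {1..n} \<and> even (card A)}"
  have "bij_betw (\<lambda>A. A - {n}) ?E (Pow {1..<n})"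
  proof (rule bij_betw_byWitness[where f' = "\<lambda>B. if even (card B) then B else insert n B"])
    show "\<forall>a\<in>?E. (if even (card (a - {n})) then a - {n} else insert n (a - {n})) = a"
    proof
      fix a assume a: "a \<in> ?E"
      then have fin: "finite a" using finite_subset by blast
      show "(if even (card (a - {n})) then a - {n} else insert n (a - {n})) = a"
      proof (cases "n \<in> a")
        case True
        then have "card a = Suc (card (a - {n}))"
          using fin by (metis card_Suc_Diff1)
        then show ?thesis using a True by auto
      next
        case False
        then show ?thesis using a by auto
      qed
    qed
    show "\<forall>b\<in>Pow {1..<n}. (if even (card b) then b else insert n b) - {n} = b"
      by auto
    show "(\<lambda>A. A - {n}) ` ?E \<subseteq> Pow {1..<n}"
      by force
    show "(\<lambda>B. if even (card B) then B else insert n B) ` Pow {1..<n} \<subseteq> ?E"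
    proof
      fix x assume "x \<in> (\<lambda>B. if even (card B) then B else insert n B) ` Pow {1..<n}"
      then obtain B where B: "B \<subseteq> {1..<n}" and x: "x = (if even (card B) then B else insert n B)"
        by auto
      have fin: "finite B" and nB: "n \<notin> B" using B finite_subset by auto
      have sub: "B \<subseteq> {1..n}" using B by force
      show "x \<in> ?E"
        using x fin nB sub assms by auto
    qed
  qed
  then have "card ?E = card (Pow {1..<n})" by (rule bij_betw_same_card)
  then show ?thesis by (simp add: card_Pow)
qed

lemma max_op_density_is_maximum:
  assumes "0 < \<epsilon>" "\<epsilon> < 1/2" "real n \<ge> 1 / \<epsilon>"
  shows "op_density_bound n \<epsilon> (max_op_density n \<epsilon>)"
    and "op_density_bound n \<epsilon> c \<Longrightarrow> c \<le> max_op_density n \<epsilon>"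
proof -
  let ?F = "large_even_families n \<epsilon>"
  define r where "r \<A> = real (odd_pair_number \<A>) / real (card \<A> choose 2)" for \<A>
  have "1 / \<epsilon> > 2" using assms by (simp add: field_simps)
  then have n: "real n > 2" using assms by linarith
  have en: "\<epsilon> * real n \<ge> 1" using assms by (simp add: field_simps)
  have "?F \<subseteq> Pow (Pow {1..n})" by (auto simp: large_even_families_def)
  then have fin: "finite ?F" by (rule finite_subset) simp
  have "2 powr ((1 - \<epsilon>) * real n) \<le> 2 powr (real (n - 1))"
    using en n by (intro powr_mono) (auto simp: algebra_simps of_nat_diff)
  also have "\<dots> = real (card {A. A \<subseteq> {1..n} \<and> even (card A)})"
    by (subst card_even_subsets) (use n in \<open>auto simp only: powr_realpow\<close>, simp_all)
  finally have "{A. A \<subseteq> {1..n} \<and> even (card A)} \<in> ?F"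
    by (auto simp: large_even_families_def even_sized_def)
  then have ne: "?F \<noteq> {}" by blast
  have pos: "real (card \<A> choose 2) > 0" if "\<A> \<in> ?F" for \<A>
  proof -
    have "1 < (1 - \<epsilon>) * real n"
    proof -
      have "1/2 * real n \<le> (1 - \<epsilon>) * real n" using assms n by (intro mult_right_mono) auto
      then show ?thesis using n by linarith
    qed
    then have "(2::real) powr 1 < 2 powr ((1 - \<epsilon>) * real n)"
      by (intro powr_less_mono) auto
    then have "card \<A> > 2" using that by (auto simp: large_even_families_def)
    then show ?thesis by (simp add: zero_less_binomial)
  qed
  have iff: "op_density_bound n \<epsilon> c \<longleftrightarrow> c \<le> Min (r ` ?F)" for c
    using fin ne pos by (simp add: op_density_bound_def r_def pos_le_divide_eq)
  have "max_op_density n \<epsilon> = Min (r ` ?F)"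
    unfolding max_op_density_def iff by (rule Greatest_equality) auto
  then show "op_density_bound n \<epsilon> (max_op_density n \<epsilon>)" "op_density_bound n \<epsilon> c \<Longrightarrow> c \<le> max_op_density n \<epsilon>"
    using iff by auto
qed

end

theory Submission
  imports Defs "HOL-Analysis.Convex"
begin

text \<open>
  Write \<open>\<chi>(A,B) = (-1)\<^bsup>|A \<inter> B|\<^esup>\<close> and \<open>s = \<Sum>\<chi>(A,B)\<close>, the sum over all ordered pairs of members of
  a family with \<open>N\<close> members. In an even-sized family the diagonal pairs carry the sign
  \<open>+1\<close>, so only the odd pairs count negatively, each of them twice. This gives
  \<open>s = N\<^sup>2 - 4 op\<close> (\<open>signed_pair_sum_eq\<close>): the density of odd pairs is close to
  \<open>1/2\<close> exactly when \<open>s\<close> is small compared with \<open>N\<^sup>2\<close>.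

  For the lower bound, \<open>\<chi>\<close> on all subsets of \<open>[n]\<close> is the Sylvester-Hadamard matrix of order
  \<open>2\<^sup>n\<close>. Its rows are orthogonal, so its operator norm is \<open>2\<^bsup>n/2\<^esup>\<close>, and applied to the
  indicator vector of the family this yields \<open>s \<le> 2\<^bsup>n/2\<^esup> N\<close> (\<open>signed_pair_sum_le\<close>). For
  \<open>N \<ge> 2\<^bsup>(1-\<epsilon>)n\<^esup>\<close> the right-hand side is at most \<open>2\<^bsup>(\<epsilon>-1/2)n\<^esup> N\<^sup>2\<close>.

  For the upper bound, take all \<open>2\<^bsup>n-1\<^esup>\<close> even subsets of \<open>[n]\<close>. A row of \<open>\<chi>\<close>, restricted to the
  even subsets, sums to zero unless it belongs to the radical of the form
  \<open>|A \<inter> B| mod 2\<close> on them. The radical consists of the empty set and, for even \<open>n\<close>,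
  also of \<open>[n]\<close>. Hence \<open>s = N\<close> or \<open>s = 2N\<close> according to the parity of \<open>n\<close>
  (\<open>signed_pair_sum_even_subsets\<close>), which is the stated bound.
\<close>

section \<open>Odd pairs and the signed pair sum\<close>

definition intersection_sign :: "'a set \<Rightarrow> 'a set \<Rightarrow> real" where
  "intersection_sign A B = (- 1) ^ card (A \<inter> B)"

definition signed_pair_sum :: "'a set set \<Rightarrow> real" where
  "signed_pair_sum \<A> = (\<Sum>A\<in>\<A>. \<Sum>B\<in>\<A>. intersection_sign A B)"

lemma card_image_unordered_pairs:
  assumes "finite R" "sym R" "irrefl R"
  shows "card R = 2 * card ((\<lambda>(a, b). {a, b}) ` R)"
proof -
  let ?f = "\<lambda>(a, b). {a, b}"
  have fibre: "card {p \<in> R. ?f p = e} = 2" if e: "e \<in> ?f ` R" for e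
  proof -
    obtain a b where ab: "(a, b) \<in> R" "e = {a, b}" using e by auto
    have "(b, a) \<in> R" "a \<noteq> b" using ab assms by (auto simp: sym_def irrefl_def)
    then have "{p \<in> R. ?f p = e} = {(a, b), (b, a)}"
      using ab by (auto simp: doubleton_eq_iff)
    then show ?thesis using \<open>a \<noteq> b\<close> by simp
  qed
  have "card R = (\<Sum>e\<in>?f ` R. card {p \<in> R. ?f p = e})"
    using sum.image_gen[OF assms(1), of "\<lambda>_. 1 :: nat" ?f] by simp
  also have "\<dots> = (\<Sum>e\<in>?f ` R. 2)" using fibre by (intro sum.cong) auto
  finally show ?thesis by simp
qed

text \<open>
  Every sign is \<open>1 - 2\<cdot>[odd intersection]\<close>. Evenness of the members is what keeps the diagonal out of the
  ordered odd pairs, so that those are counted by twice the odd pair number.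
\<close>

lemma signed_pair_sum_eq:
  assumes "finite \<A>" "even_sized \<A>"
  shows "signed_pair_sum \<A> = real (card \<A>) ^ 2 - 4 * real (odd_pair_number \<A>)"
proof -
  let ?R = "{(A, B) \<in> \<A> \<times> \<A>. odd (card (A \<inter> B))}"
  have fin: "finite (\<A> \<times> \<A>)" "finite ?R"
    using assms by (auto intro: finite_subset[of _ "\<A> \<times> \<A>"])
  have "sym ?R" "irrefl ?R"
    using assms by (auto simp: sym_def irrefl_def even_sized_def Int_commute)
  then have "card ?R = 2 * card ((\<lambda>(A, B). {A, B}) ` ?R)"
    by (rule card_image_unordered_pairs[OF fin(2)])
  also have "(\<lambda>(A, B). {A, B}) ` ?R =
      {{A, B} | A B. A \<in> \<A> \<and> B \<in> \<A> \<and> A \<noteq> B \<and> odd (card (A \<inter> B))}"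
    using assms by (force simp: even_sized_def)
  finally have card: "card ?R = 2 * odd_pair_number \<A>"
    by (simp add: odd_pair_number_def)
  have "signed_pair_sum \<A> = (\<Sum>p\<in>\<A> \<times> \<A>. 1 - 2 * (if p \<in> ?R then 1 else 0))"
    unfolding signed_pair_sum_def sum.cartesian_product
    by (rule sum.cong) (auto simp: intersection_sign_def)
  also have "\<dots> = real (card (\<A> \<times> \<A>)) - 2 * (\<Sum>p\<in>\<A> \<times> \<A>. if p \<in> ?R then 1 else 0)"
    by (simp only: sum_subtractf sum_distrib_left[symmetric]) simp
  also have "(\<Sum>p\<in>\<A> \<times> \<A>. if p \<in> ?R then 1 else 0) = real (card ?R)"
  proof -
    have "(\<A> \<times> \<A>) \<inter> {p. p \<in> ?R} = ?R" by auto
    then show ?thesis using fin(1) by (simp only: sum.If_cases) simp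
  qed
  finally show ?thesis
    using card by (simp add: card_cartesian_product power2_eq_square)
qed

lemma real_choose_two: "real (N choose 2) = real N * (real N - 1) / 2"
  by (cases N) (simp_all add: choose_two real_of_nat_div algebra_simps)

section \<open>Cancellation by toggling elements\<close>

lemma card_sym_diff_parity:
  assumes "finite A" "finite B"
  shows "even (card (sym_diff A B)) \<longleftrightarrow> (even (card A) \<longleftrightarrow> even (card B))"
proof -
  have "card (sym_diff A B) + 2 * card (A \<inter> B) = card A + card B"
  proof -
    have "card (sym_diff A B) = card (A - B) + card (B - A)"
      using assms by (intro card_Un_disjoint) auto
    moreover have "card A = card (A - B) + card (A \<inter> B)"
      using assms card_Int_Diff[of A B] by simp
    moreover have "card B = card (B - A) + card (A \<inter> B)"
      using assms card_Int_Diff[of B A] by (simp add: Int_commute)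
    ultimately show ?thesis by simp
  qed
  then show ?thesis by presburger
qed

lemma intersection_sign_sym_diff:
  assumes "finite A"
  shows "intersection_sign A (sym_diff B C) = intersection_sign A B * intersection_sign A C"
proof -
  have "A \<inter> sym_diff B C = sym_diff (A \<inter> B) (A \<inter> C)" by auto
  then show ?thesis
    using assms card_sym_diff_parity[of "A \<inter> B" "A \<inter> C"]
    by (simp add: intersection_sign_def minus_one_power_iff)
qed

lemma intersection_sign_commute: "intersection_sign A B = intersection_sign B A"
  by (simp add: intersection_sign_def Int_commute)

text \<open>
  The involution \<open>B \<mapsto> B \<triangle> T\<close> of \<open>\<F>\<close> reverses every sign, so the terms cancel in pairs.
\<close>

lemma sum_intersection_sign_eq_0:
  assumes "finite A" and closed: "\<And>B. B \<in> \<F> \<Longrightarrow> sym_diff B T \<in> \<F>"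
    and odd: "odd (card (A \<inter> T))"
  shows "(\<Sum>B\<in>\<F>. intersection_sign A B) = 0"
proof -
  have invol: "sym_diff (sym_diff B T) T = B" for B by auto
  have "(\<Sum>B\<in>\<F>. intersection_sign A B) = (\<Sum>B\<in>\<F>. - intersection_sign A B)"
  proof (rule sum.reindex_bij_witness[where i = "\<lambda>B. sym_diff B T" and j = "\<lambda>B. sym_diff B T"])
    fix B
    show "- intersection_sign A (sym_diff B T) = intersection_sign A B"
      using odd intersection_sign_sym_diff[OF assms(1), of B T]
      by (simp add: intersection_sign_def)
  qed (use closed invol in simp_all)
  then show ?thesis by (simp add: sum_negf)
qed

section \<open>The lower bound\<close>

text \<open>
  Orthogonality of the rows of the Sylvester-Hadamard matrix: the product of two rows is the row
  of the symmetric difference, and toggling one element of that difference cancels its sum.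
\<close>

lemma intersection_sign_orthogonal:
  assumes "finite X" "B \<subseteq> X" "C \<subseteq> X"
  shows "(\<Sum>A\<in>Pow X. intersection_sign A B * intersection_sign A C) =
    (if B = C then 2 ^ card X else 0)"
proof -
  have eq: "(\<Sum>A\<in>Pow X. intersection_sign A B * intersection_sign A C) =
      (\<Sum>A\<in>Pow X. intersection_sign (sym_diff B C) A)"
    using assms(1)
    by (intro sum.cong)
      (auto simp: intersection_sign_sym_diff finite_subset intersection_sign_commute[of "sym_diff B C"])
  show ?thesis
  proof (cases "B = C")
    case True
    then show ?thesis unfolding eq using assms by (simp add: intersection_sign_def card_Pow)
  next
    case False
    then obtain x where x: "x \<in> sym_diff B C" by auto
    have "(\<Sum>A\<in>Pow X. intersection_sign (sym_diff B C) A) = 0"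
    proof (rule sum_intersection_sign_eq_0[where T = "{x}"])
      show "finite (sym_diff B C)" using assms by (auto intro: finite_subset)
      show "sym_diff A {x} \<in> Pow X" if "A \<in> Pow X" for A using that x assms by auto
      have "sym_diff B C \<inter> {x} = {x}" using x by auto
      then show "odd (card (sym_diff B C \<inter> {x}))" by simp
    qed
    then show ?thesis using eq False by simp
  qed
qed

text \<open>
  Cauchy-Schwarz bounds the square of the sum by \<open>|\<A>|\<close> times the sum of the squared row sums.
  Enlarging the latter from the rows in \<open>\<A>\<close> to all subsets of \<open>X\<close> makes orthogonality
  applicable, and only the diagonal survives.
\<close>

lemma signed_pair_sum_le:
  assumes "finite X" "\<A> \<subseteq> Pow X"
  shows "signed_pair_sum \<A> \<le> 2 powr (real (card X) / 2) * real (card \<A>)"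
proof -
  define row where "row A = (\<Sum>B\<in>\<A>. intersection_sign A B)" for A
  have fin: "finite \<A>" using assms by (simp add: finite_subset)
  have "(\<Sum>A\<in>Pow X. row A ^ 2) =
      (\<Sum>A\<in>Pow X. \<Sum>B\<in>\<A>. \<Sum>C\<in>\<A>. intersection_sign A B * intersection_sign A C)"
    by (simp add: row_def power2_eq_square sum_product)
  also have "\<dots> = (\<Sum>B\<in>\<A>. \<Sum>A\<in>Pow X. \<Sum>C\<in>\<A>. intersection_sign A B * intersection_sign A C)"
    by (rule sum.swap)
  also have "\<dots> = (\<Sum>B\<in>\<A>. \<Sum>C\<in>\<A>. \<Sum>A\<in>Pow X. intersection_sign A B * intersection_sign A C)"
    by (intro sum.cong sum.swap refl)
  also have "\<dots> = (\<Sum>B\<in>\<A>. \<Sum>C\<in>\<A>. if B = C then 2 ^ card X else 0)"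
    using assms by (intro sum.cong intersection_sign_orthogonal) auto
  also have "\<dots> = real (card \<A>) * 2 ^ card X" using fin by simp
  finally have all_rows: "(\<Sum>A\<in>Pow X. row A ^ 2) = real (card \<A>) * 2 ^ card X" .
  have "signed_pair_sum \<A> ^ 2 = (\<Sum>A\<in>\<A>. row A) ^ 2"
    by (simp add: signed_pair_sum_def row_def)
  also have "\<dots> \<le> (\<Sum>A\<in>\<A>. row A ^ 2) * real (card \<A>)"
    by (rule sum_squared_le_sum_of_squares)
  also have "\<dots> \<le> (\<Sum>A\<in>Pow X. row A ^ 2) * real (card \<A>)"
    using assms by (simp add: mult_right_mono sum_mono2)
  also have "\<dots> = (2 powr (real (card X) / 2) * real (card \<A>)) ^ 2"
  proof -
    have "(2 powr (real (card X) / 2)) ^ 2 = (2::real) ^ card X"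
      by (simp add: power2_eq_square powr_add[symmetric] powr_realpow)
    then show ?thesis
      unfolding all_rows by (simp add: power_mult_distrib) (simp add: power2_eq_square)
  qed
  finally show ?thesis by (rule power2_le_imp_le) simp
qed

text \<open>
  The exponents match: \<open>2\<^bsup>n/2\<^esup> = 2\<^bsup>(\<epsilon>-1/2)n\<^esup> \<cdot> 2\<^bsup>(1-\<epsilon>)n\<^esup>\<close>, and the second factor is at
  most \<open>|\<A>|\<close>.
\<close>

lemma op_density_bound_lower:
  assumes "\<epsilon> < 1/2"
  shows "op_density_bound n \<epsilon> (1/2 * (1 - 2 powr ((\<epsilon> - 1/2) * real n)))"
  unfolding op_density_bound_def
proof
  fix \<A> assume "\<A> \<in> large_even_families n \<epsilon>"
  then have sub: "\<A> \<subseteq> Pow {1..n}" and even: "even_sized \<A>"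
    and large: "2 powr ((1 - \<epsilon>) * real n) \<le> real (card \<A>)"
    by (auto simp: large_even_families_def)
  define N where "N = real (card \<A>)"
  define \<delta> where "\<delta> = (2::real) powr ((\<epsilon> - 1/2) * real n)"
  have "finite \<A>" using sub by (rule finite_subset) simp
  then have s: "signed_pair_sum \<A> = N ^ 2 - 4 * real (odd_pair_number \<A>)"
    using even by (simp add: signed_pair_sum_eq N_def)
  have N: "N \<ge> 0" by (simp add: N_def)
  have \<delta>: "0 \<le> \<delta>" "\<delta> \<le> 1"
    using assms powr_mono[of "(\<epsilon> - 1/2) * real n" 0 2]
    by (auto simp: \<delta>_def mult_nonpos_nonneg)
  have "2 powr (real n / 2) = \<delta> * 2 powr ((1 - \<epsilon>) * real n)"
    by (simp add: \<delta>_def powr_add[symmetric] algebra_simps)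
  also have "\<dots> \<le> \<delta> * N" using large \<delta> by (simp add: N_def mult_left_mono)
  finally have "2 powr (real n / 2) * N \<le> \<delta> * N * N" using N by (rule mult_right_mono)
  moreover have "signed_pair_sum \<A> \<le> 2 powr (real n / 2) * N"
    using signed_pair_sum_le[OF _ sub] by (simp add: N_def)
  ultimately have "N ^ 2 - 4 * real (odd_pair_number \<A>) \<le> \<delta> * N * N" using s by linarith
  \<comment> \<open>Replacing \<open>N\<^sup>2\<close> by \<open>N(N - 1)\<close>, which is twice the number of pairs, loses
    \<open>(1 - \<delta>)N\<close>; this is nonnegative.\<close>
  moreover have "\<delta> * N \<le> N" using \<delta> N mult_right_mono[of \<delta> 1 N] by simp
  ultimately have "(1 - \<delta>) * (N * (N - 1)) \<le> 4 * real (odd_pair_number \<A>)"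
    by (simp add: algebra_simps power2_eq_square)
  then show "1/2 * (1 - 2 powr ((\<epsilon> - 1/2) * real n)) * real (card \<A> choose 2)
      \<le> real (odd_pair_number \<A>)"
    by (simp add: real_choose_two N_def \<delta>_def)
qed

section \<open>The upper bound\<close>

definition even_subsets :: "nat \<Rightarrow> nat set set" where
  "even_subsets n = {A. A \<subseteq> {1..n} \<and> even (card A)}"

lemma even_subsets_props:
  shows finite_even_subsets: "finite (even_subsets n)"
    and even_sized_even_subsets: "even_sized (even_subsets n)"
    and card_even_subsets': "n \<ge> 1 \<Longrightarrow> card (even_subsets n) = 2 ^ (n - 1)"
  using card_even_subsets[of n]
  by (auto simp: even_subsets_def even_sized_def intro: finite_subset[of _ "Pow {1..n}"])

text \<open>
  A set \<open>A\<close> other than \<open>\<emptyset>\<close> and \<open>[n]\<close> has some \<open>i \<in> A\<close> and \<open>j \<notin> A\<close>. Toggling both preserves the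
  parity of a set and changes that of its intersection with \<open>A\<close>.
\<close>

lemma sum_intersection_sign_even_subsets:
  assumes "A \<in> even_subsets n"
  shows "(\<Sum>B\<in>even_subsets n. intersection_sign A B) =
    (if A = {} \<or> A = {1..n} then real (card (even_subsets n)) else 0)"
proof (cases "A = {} \<or> A = {1..n}")
  case True
  have "intersection_sign A B = 1" if "B \<in> even_subsets n" for B
  proof -
    have "A \<inter> B = {} \<or> A \<inter> B = B" using True that by (auto simp: even_subsets_def)
    then show ?thesis using that by (auto simp: intersection_sign_def even_subsets_def)
  qed
  then show ?thesis using True by simp
next
  case False
  have A: "A \<subseteq> {1..n}" using assms by (simp add: even_subsets_def)
  obtain i j where ij: "i \<in> A" "j \<in> {1..n}" "j \<notin> A" using False A by blast
  have "(\<Sum>B\<in>even_subsets n. intersection_sign A B) = 0"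
  proof (rule sum_intersection_sign_eq_0[where T = "{i, j}"])
    show "finite A" using A by (rule finite_subset) simp
    have "A \<inter> {i, j} = {i}" using ij by auto
    then show "odd (card (A \<inter> {i, j}))" by simp
    show "sym_diff B {i, j} \<in> even_subsets n" if "B \<in> even_subsets n" for B
    proof -
      have B: "B \<subseteq> {1..n}" "even (card B)" using that by (auto simp: even_subsets_def)
      have "finite B" using B(1) by (rule finite_subset) simp
      moreover from ij have "i \<noteq> j" by auto
      then have "card {i, j} = 2" by simp
      ultimately have "even (card (sym_diff B {i, j}))"
        using B card_sym_diff_parity[of B "{i, j}"] by simp
      moreover have "sym_diff B {i, j} \<subseteq> {1..n}" using B ij A by auto
      ultimately show ?thesis unfolding even_subsets_def by blast
    qed
  qed
  then show ?thesis using False by simp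
qed

lemma signed_pair_sum_even_subsets:
  assumes "n \<ge> 1"
  shows "signed_pair_sum (even_subsets n) = (if odd n then 1 else 2) * 2 ^ (n - 1)"
proof -
  let ?R = "{A \<in> even_subsets n. A = {} \<or> A = {1..n}}"
  have "signed_pair_sum (even_subsets n) =
      (\<Sum>A\<in>even_subsets n. if A = {} \<or> A = {1..n} then real (card (even_subsets n)) else 0)"
    unfolding signed_pair_sum_def by (intro sum.cong sum_intersection_sign_even_subsets refl)
  also have "\<dots> = (\<Sum>A\<in>?R. real (card (even_subsets n)))"
    by (rule sum.inter_filter[symmetric]) (rule finite_even_subsets)
  also have "\<dots> = real (card ?R) * 2 ^ (n - 1)"
    using assms by (simp add: card_even_subsets')
  also have "?R = (if odd n then {{}} else {{}, {1..n}})"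
    by (auto simp: even_subsets_def)
  also have "real (card \<dots>) = (if odd n then 1 else 2)"
    using assms by simp
  finally show ?thesis .
qed

lemma odd_pair_density_even_subsets:
  assumes "n \<ge> 2"
  shows "real (odd_pair_number (even_subsets n)) =
    (if odd n then 1/2 else 1/2 * (1 - 1 / (2 ^ (n - 1) - 1))) *
      real (card (even_subsets n) choose 2)"
proof -
  define N where "N = (2::real) ^ (n - 1)"
  have "(2::real) ^ 1 \<le> 2 ^ (n - 1)" using assms by (intro power_increasing) auto
  then have N: "N - 1 > 0" by (simp add: N_def)
  have card: "real (card (even_subsets n)) = N"
    using assms by (simp add: card_even_subsets' N_def)
  have op: "4 * real (odd_pair_number (even_subsets n)) = N ^ 2 - (if odd n then 1 else 2) * N"
    using signed_pair_sum_eq[OF finite_even_subsets even_sized_even_subsets, of n]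
      signed_pair_sum_even_subsets[of n] assms card
    by (simp add: N_def)
  show ?thesis
  proof (cases "odd n")
    case True
    then show ?thesis
      using op by (simp add: real_choose_two card power2_eq_square algebra_simps)
  next
    case False
    have "1/2 * (1 - 1 / (N - 1)) * (N * (N - 1) / 2) = (N ^ 2 - 2 * N) / 4"
      using N by (simp add: field_simps power2_eq_square)
    then show ?thesis
      unfolding real_choose_two card N_def[symmetric] using op False by simp
  qed
qed

lemma even_subsets_large:
  assumes "n \<ge> 1" "\<epsilon> * real n \<ge> 1"
  shows "even_subsets n \<in> large_even_families n \<epsilon>"
proof -
  have "2 powr ((1 - \<epsilon>) * real n) \<le> 2 powr real (n - 1)"
    using assms by (intro powr_mono) (auto simp: algebra_simps of_nat_diff)
  also have "\<dots> = real (card (even_subsets n))"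
    using assms by (simp add: card_even_subsets' powr_realpow del: of_nat_diff)
  finally show ?thesis
    using even_sized_even_subsets[of n]
    by (auto simp: large_even_families_def even_subsets_def)
qed

lemma op_density_bound_upper:
  assumes "n \<ge> 2" "\<epsilon> * real n \<ge> 1" "op_density_bound n \<epsilon> c"
  shows "c \<le> (if odd n then 1/2 else 1/2 * (1 - 1 / (2 ^ (n - 1) - 1)))" (is "c \<le> ?u")
proof -
  have "c * real (card (even_subsets n) choose 2) \<le> real (odd_pair_number (even_subsets n))"
    using assms even_subsets_large[of n \<epsilon>] by (auto simp: op_density_bound_def)
  also have "\<dots> = ?u * real (card (even_subsets n) choose 2)"
    by (rule odd_pair_density_even_subsets) fact
  finally have le: "c * real (card (even_subsets n) choose 2) \<le>
    ?u * real (card (even_subsets n) choose 2)" .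
  have "(2::nat) ^ 1 \<le> 2 ^ (n - 1)" using assms by (intro power_increasing) auto
  then have "0 < real (card (even_subsets n) choose 2)"
    using assms by (simp add: card_even_subsets' zero_less_binomial)
  with le show ?thesis by (rule mult_right_le_imp_le)
qed

section \<open>The bounds and the limit\<close>

theorem theorem1p6:
  fixes \<epsilon> :: real
  assumes "0 < \<epsilon>" and "\<epsilon> < 1/2"
  shows "(\<forall>n::nat. real n \<ge> 1 / \<epsilon> \<longrightarrow>
            1/2 * (1 - 2 powr ((\<epsilon> - 1/2) * real n)) \<le> max_op_density n \<epsilon> \<and>
            max_op_density n \<epsilon> \<le> (if odd n then 1/2 else 1/2 * (1 - 1 / (2 ^ (n - 1) - 1)))) \<and>
         (\<lambda>n. max_op_density n \<epsilon>) \<longlonglongrightarrow> 1/2"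
proof -
  let ?l = "\<lambda>n::nat. 1/2 * (1 - 2 powr ((\<epsilon> - 1/2) * real n))"
  let ?u = "\<lambda>n::nat. if odd n then 1/2 else 1/2 * (1 - 1 / (2 ^ (n - 1) - 1)) :: real"
  have bounds: "?l n \<le> max_op_density n \<epsilon> \<and> max_op_density n \<epsilon> \<le> ?u n"
    if n: "real n \<ge> 1 / \<epsilon>" for n
  proof -
    have "\<epsilon> * real n \<ge> 1" using n assms by (simp add: field_simps)
    moreover have "1 / \<epsilon> > 2" using assms by (simp add: field_simps)
    then have "n \<ge> 2" using n by linarith
    ultimately have "max_op_density n \<epsilon> \<le> ?u n"
      using max_op_density_is_maximum(1)[OF assms n] by (intro op_density_bound_upper)
    moreover have "?l n \<le> max_op_density n \<epsilon>"
      using max_op_density_is_maximum(2)[OF assms n] op_density_bound_lower[OF assms(2)] by blast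
    ultimately show ?thesis by blast
  qed
  have u_le: "?u n \<le> 1/2" for n by simp
  have large: "\<forall>\<^sub>F n in sequentially. real n \<ge> 1 / \<epsilon>"
    using filterlim_real_sequentially by (simp add: filterlim_at_top)
  have l_lim: "?l \<longlonglongrightarrow> 1/2"
  proof -
    have "2 powr (\<epsilon> - 1/2) < (1::real)"
      using assms powr_less_mono[of "\<epsilon> - 1/2" 0 2] by simp
    then have "(\<lambda>n. (2 powr (\<epsilon> - 1/2)) ^ n) \<longlonglongrightarrow> (0::real)"
      by (rule LIMSEQ_realpow_zero[OF powr_ge_zero])
    then have "(\<lambda>n. 1/2 * (1 - (2 powr (\<epsilon> - 1/2)) ^ n)) \<longlonglongrightarrow> 1/2 * (1 - (0::real))"
      by (intro tendsto_mult tendsto_diff tendsto_const)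
    then show ?thesis by (simp add: powr_power mult.commute)
  qed
  have "(\<lambda>n. max_op_density n \<epsilon>) \<longlonglongrightarrow> 1/2"
  proof (rule tendsto_sandwich[OF _ _ l_lim tendsto_const])
    show "\<forall>\<^sub>F n in sequentially. ?l n \<le> max_op_density n \<epsilon>"
      using large by (rule eventually_mono) (use bounds in blast)
    show "\<forall>\<^sub>F n in sequentially. max_op_density n \<epsilon> \<le> 1/2"
      using large by (rule eventually_mono) (use bounds u_le order_trans in blast)
  qed
  with bounds show ?thesis by blast
qed

end
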